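(* The deletion equivalence $\equiv_D$ is fully abstract with respect to $(Ob,\{\cup,\overline{(\cdot)}^{\sigma},(\cdot)\setminus\sigma,\rho(\cdot)\})$. That is, for all program modules $\mathcal P,\mathcal Q$ over $\Sigma$: if $Ob(C[\![\mathcal P]\!])=Ob(C[\![\mathcal Q]\!])$ for every context $C[\![\mathcal X]\!]$ built with these operations, then $\mathcal P\equiv_D\mathcal Q$.
   Context: Terms. $\Sigma=(DS_\Sigma,FS_\Sigma)$ consists of countable disjoint sets of constructor symbols and of (defined) function symbols, each with an arity; $DS^n_\Sigma$, $FS^n_\Sigma$ are the symbols of arity $n\ge 0$. $\mathcal V$ is a countably infinite set of variables; $\bot$ is an extra 0-ary constructor. $\mathbf{Term}_\bot$ is the set of terms over $DS_\Sigma\cup FS_\Sigma\cup\{\bot\}$ and $\mathcal V$; $\mathbf{CTerm}_\bot$ is the subset of terms without function symbols; $\mathbf{Term}$, $\mathbf{CTerm}$ are the respective subsets of terms not containing $\bot$. $\mathbf{CSubst}_\bot$ (resp. $\mathbf{CSubst}$) is the set of maps $\theta:\mathcal V\to\mathbf{CTerm}_\bot$ (resp. $\mathcal V\to\mathbf{CTerm}$), extended to terms and written $t\theta$. Formulas are reduction statements $a\to b$ and joinability statements $a\bowtie b$ with $a,b\in\mathbf{Term}_\bot$. $\sqsubseteq$ is the least partial order on $\mathbf{CTerm}_\bot$ with $\bot\sqsubseteq t$ and $c(\overline s)\sqsubseteq c(\overline t)$ whenever $c\in DS^n_\Sigma$ and $s_i\sqsubseteq t_i$ for all $i$; $\langle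 t\rangle=\{s\in\mathbf{CTerm}_\bot\mid s\sqsubseteq t\}$. A cone is a non-empty subset of $\mathbf{CTerm}_\bot$ closed downwards under $\sqsubseteq$. Programs. A program is a set $\mathcal R$ of rules $f(\overline t)\to r\Leftarrow C$ with $f\in FS^n_\Sigma$, $\overline t$ an $n$-tuple of terms of $\mathbf{CTerm}$ in which no variable occurs twice, $r\in\mathbf{Term}_\bot$, and $C$ a finite set of joinability statements between terms of $\mathbf{Term}$. $[\mathcal R]_\bot$ is the set of all instances $(l\to r\Leftarrow C)\theta$ of rules of $\mathcal R$ with $\theta\in\mathbf{CSubst}_\bot$. Provability. $\mathcal R\vdash_{CRWL}\varphi$ means $\varphi$ is derivable with: (Bo) $e\to\bot$ for $e\in\mathbf{Term}_\bot$; (RR) $e\to e$ for $e\in\mathcal V\cup DS^0_\Sigma$; (DS) from $e_i\to t_i$ ($1\le i\le n$) infer $c(\overline e)\to c(\overline t)$, for $c\in DS^n_\Sigma$; (OR) from $e_i\to t_i$ ($1\le i\le n$), all statements of $C$, and $r\to t$ infer $f(\overline e)\to t$, if $(f(\overline t)\to r\Leftarrow C)\in[\mathcal R]_\bot$ and $t\neq\bot$; (Jo) from $a\to t$ and $b\to t$ infer $a\bowtie b$, if $t\in\mathbf{CTerm}$. Term algebras. A (CRWL-)term algebra $\mathcal A$ has carrier $\mathbf{CTerm}_\bot$, interprets each $c\in DS^n_\Sigma$ by $c^{\mathcal A}(\overline t)=\langle c(\overline t)\rangle$, and each $f\in FS^n_\Sigma$ by a monotonic map $f^{\mathcal A}$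 from $(\mathbf{CTerm}_\bot)^n$ to cones ordered by inclusion (a cone if $n=0$). $\mathbf{TAlg}_\Sigma$ is the set of them, ordered by $\mathcal A\sqsubseteq\mathcal B$ iff $f^{\mathcal A}(\overline t)\subseteq f^{\mathcal B}(\overline t)$ for all $f,\overline t$. $\mathcal A$ is consistent iff $\{u\theta\mid u\in f^{\mathcal A}(\overline t)\}\subseteq f^{\mathcal A}(\overline t\theta)$ for all $f\in FS^n_\Sigma$, $t_i\in\mathbf{CTerm}_\bot$, $\theta\in\mathbf{CSubst}$; $\mathbf{CTAlg}_\Sigma$ is the set of consistent term algebras. Evaluation under $\eta:\mathcal V\to\mathbf{CTerm}_\bot$: $[\![\bot]\!]^{\mathcal A}_\eta=\langle\bot\rangle$, $[\![X]\!]^{\mathcal A}_\eta=\langle\eta(X)\rangle$, $[\![h(e_1,\dots,e_n)]\!]^{\mathcal A}_\eta=\bigcup\{h^{\mathcal A}(u_1,\dots,u_n)\mid u_i\in[\![e_i]\!]^{\mathcal A}_\eta\}$. $id$ is the identity valuation. $\mathcal A\models_\eta a\bowtie b$ iff $[\![a]\!]^{\mathcal A}_\eta\cap[\![b]\!]^{\mathcal A}_\eta$ contains an element of $\mathbf{CTerm}$ (a maximal element); $\mathcal A\models_\eta C$ iff this holds for all statements of $C$. For a program $\mathcal R$, $\mathcal T_{\mathcal R}:\mathbf{TAlg}_\Sigma\to\mathbf{TAlg}_\Sigma$ is given by $f^{\mathcal T_{\mathcal R}(\mathcal A)}(\overline t)=\{t\mid\exists(f(\overline s)\to r\Leftarrow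 C)\in[\mathcal R]_\bot,\ s_i\sqsubseteq t_i\text{ for all }i,\ \mathcal A\models_{id}C,\ t\in[\![r]\!]^{\mathcal A}_{id}\}\cup\{\bot\}$. $\mathcal M_{\mathcal R}$ is the term algebra with $f^{\mathcal M_{\mathcal R}}(\overline t)=\{r\in\mathbf{CTerm}_\bot\mid\mathcal R\vdash_{CRWL}f(\overline t)\to r\}$. Modules. A module is $\mathcal P=\langle\sigma_p,\sigma_e,\mathcal R\rangle$ with $\mathcal R$ a program whose rules have right-hand sides $r\ne\bot$, $\sigma_e=exp(\mathcal P)$ the set of function symbols having a defining rule in $\mathcal R$, and $\sigma_p$ the set of function symbols occurring in $\mathcal R$ without a defining rule in $\mathcal R$; $rl(\mathcal P)=\mathcal R$, and $\mathcal T_{\mathcal P}$, $\mathcal M_{\mathcal P}$ mean $\mathcal T_{rl(\mathcal P)}$, $\mathcal M_{rl(\mathcal P)}$. A module is determined by its rules. Operations ($\sigma\subseteq FS_\Sigma$): - union: $rl(\mathcal P_1\cup\mathcal P_2)=rl(\mathcal P_1)\cup rl(\mathcal P_2)$; - deletion: $rl(\mathcal P\setminus\sigma)$ is the set of rules of $\mathcal P$ that define function symbols not in $\sigma$; - closure: $rl(\overline{\mathcal P}^{\sigma})=\{crr(f(\overline t),r)\mid f\in\sigma,\ t_i\in\mathbf{CTerm}_\bot,\ r\in\mathbf{CTerm}_\bot,\ r\ne\bot,\ rl(\mathcal P)\vdash_{CRWL}f(\overline t)\to r\}$, where $crr(f(\overline t),r)$ is the rule $f(\overline t')\to r\Leftarrow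 C$ obtained by replacing in $\overline t$ each occurrence of $\bot$ and each occurrence other than the first of a variable occurring more than once by a distinct fresh variable, and letting $C$ consist of $X\bowtie Y$ for each fresh $Y$ replacing an occurrence of a repeated variable $X$, and $X\bowtie X$ for each variable $X$ of $r$ and each variable $X$ occurring exactly once in $\overline t$; - renaming: a function symbol renaming is a map $\rho:FS_\Sigma\to FS_\Sigma$ preserving arities; it acts on terms and rules by replacing every function symbol $f$ by $\rho(f)$ (constructors, variables and $\bot$ fixed), and $rl(\rho(\mathcal P))=\{\rho(R)\mid R\in rl(\mathcal P)\}$. Semantics. $Ob(\mathcal P)=\mathcal M_{\mathcal P}$. Contexts are defined inductively: the metavariable $\mathcal X$ and each module are contexts, and an operation (union, closure wrt any $\sigma$, deletion of any $\sigma$, renaming by any $\rho$) applied to contexts is a context; $C[\![\mathcal P]\!]$ is the result of replacing $\mathcal X$ by $\mathcal P$. $\mathcal P\equiv_{CM}\mathcal Q$ iff for all $\mathcal A\in\mathbf{CTAlg}_\Sigma$: $\mathcal T_{\mathcal P}(\mathcal A)\sqsubseteq\mathcal A\Leftrightarrow\mathcal T_{\mathcal Q}(\mathcal A)\sqsubseteq\mathcal A$. $\mathcal P\equiv_D\mathcal Q$ iff $\mathcal P\setminus\sigma\equiv_{CM}\mathcal Q\setminus\sigma$ for all $\sigma\subseteq FS_\Sigma$. *)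

theory Defs
  imports "HOL-Library.Countable_Set" "HOL-Library.Infinite_Typeclass"
begin

section \<open>Signatures and terms\<close>

text \<open>
  A signature assigns an arity to each of its symbols: the constructor symbols of arity \<open>n\<close> are
  the \<open>c\<close> with \<open>ds_arity S c = Some n\<close>, and similarly for the function symbols.  A type may
  contain elements that are not symbols of \<open>S\<close>, so either set of symbols can be empty.
  The constant \<open>Bot\<close> is the extra constructor, which is not part of \<open>S\<close>.
\<close>

record ('c, 'f) signature =
  ds_arity :: "'c \<Rightarrow> nat option"
  fs_arity :: "'f \<Rightarrow> nat option"

definition FS :: "('c, 'f) signature \<Rightarrow> 'f set" where
  "FS S = dom (fs_arity S)"

datatype (cons_of: 'c, funs_of: 'f, vars_of: 'v) trm =
    Var 'v
  | Bot
  | Con 'c "('c, 'f, 'v) trm list"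
  | Fun 'f "('c, 'f, 'v) trm list"

fun wf_trm :: "('c, 'f) signature \<Rightarrow> ('c, 'f, 'v) trm \<Rightarrow> bool" where
  "wf_trm S (Var x) \<longleftrightarrow> True"
| "wf_trm S Bot \<longleftrightarrow> True"
| "wf_trm S (Con c ts) \<longleftrightarrow> ds_arity S c = Some (length ts) \<and> (\<forall>t\<in>set ts. wf_trm S t)"
| "wf_trm S (Fun f ts) \<longleftrightarrow> fs_arity S f = Some (length ts) \<and> (\<forall>t\<in>set ts. wf_trm S t)"

text \<open>The occurrences of variables and of \<open>Bot\<close>, from left to right; \<open>None\<close> stands for \<open>Bot\<close>.\<close>

fun leaves :: "('c, 'f, 'v) trm \<Rightarrow> 'v option list" where
  "leaves (Var x) = [Some x]"
| "leaves Bot = [None]"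
| "leaves (Con c ts) = concat (map leaves ts)"
| "leaves (Fun f ts) = concat (map leaves ts)"

definition Term_bot :: "('c, 'f) signature \<Rightarrow> ('c, 'f, 'v) trm set" where
  "Term_bot S = {t. wf_trm S t}"

definition CTerm_bot :: "('c, 'f) signature \<Rightarrow> ('c, 'f, 'v) trm set" where
  "CTerm_bot S = {t \<in> Term_bot S. funs_of t = {}}"

definition Term :: "('c, 'f) signature \<Rightarrow> ('c, 'f, 'v) trm set" where
  "Term S = {t \<in> Term_bot S. None \<notin> set (leaves t)}"

definition CTerm :: "('c, 'f) signature \<Rightarrow> ('c, 'f, 'v) trm set" where
  "CTerm S = {t \<in> CTerm_bot S. None \<notin> set (leaves t)}"

text \<open>\<open>CTuples S n\<close> is the set of \<open>n\<close>-tuples over \<open>CTerm_bot S\<close>.\<close>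

definition CTuples :: "('c, 'f) signature \<Rightarrow> nat \<Rightarrow> ('c, 'f, 'v) trm list set" where
  "CTuples S n = {ts. length ts = n \<and> set ts \<subseteq> CTerm_bot S}"

fun subst_trm :: "('v \<Rightarrow> ('c, 'f, 'v) trm) \<Rightarrow> ('c, 'f, 'v) trm \<Rightarrow> ('c, 'f, 'v) trm" where
  "subst_trm \<theta> (Var x) = \<theta> x"
| "subst_trm \<theta> Bot = Bot"
| "subst_trm \<theta> (Con c ts) = Con c (map (subst_trm \<theta>) ts)"
| "subst_trm \<theta> (Fun f ts) = Fun f (map (subst_trm \<theta>) ts)"

definition CSubst_bot :: "('c, 'f) signature \<Rightarrow> ('v \<Rightarrow> ('c, 'f, 'v) trm) set" where
  "CSubst_bot S = {\<theta>. \<forall>x. \<theta> x \<in> CTerm_bot S}"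

definition CSubst :: "('c, 'f) signature \<Rightarrow> ('v \<Rightarrow> ('c, 'f, 'v) trm) set" where
  "CSubst S = {\<theta>. \<forall>x. \<theta> x \<in> CTerm S}"


section \<open>The approximation order and cones\<close>

inductive approx :: "('c, 'f) signature \<Rightarrow> ('c, 'f, 'v) trm \<Rightarrow> ('c, 'f, 'v) trm \<Rightarrow> bool"
  for S :: "('c, 'f) signature" where
  refl: "t \<in> CTerm_bot S \<Longrightarrow> approx S t t"
| trans: "approx S s t \<Longrightarrow> approx S t u \<Longrightarrow> approx S s u"
| bot: "t \<in> CTerm_bot S \<Longrightarrow> approx S Bot t"
| con: "ds_arity S c = Some (length ts) \<Longrightarrow> list_all2 (approx S) ss ts \<Longrightarrow>
    approx S (Con c ss) (Con c ts)"

text \<open>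
  The rules only close under reflexivity and transitivity; antisymmetry holds as well, so that
  this is indeed the least partial order on \<open>CTerm_bot S\<close> with the two closure properties.
\<close>

lemma approx_inv:
  assumes "approx S s t"
  shows "s = Bot \<or> (\<exists>x. s = Var x \<and> t = Var x) \<or>
    (\<exists>c ss ts. s = Con c ss \<and> t = Con c ts \<and> list_all2 (approx S) ss ts)"
  using assms
proof induction
  case (refl t)
  then show ?case
    by (cases t) (auto simp: CTerm_bot_def Term_bot_def intro!: list_all2_refl list.rel_refl_strong approx.refl)
next
  case (trans s t u)
  have "list_all2 (approx S) xs zs"
    if "list_all2 (approx S) xs ys" "list_all2 (approx S) ys zs" for xs ys zs
    using approx.trans that by (rule list_all2_trans)
  with trans.IH show ?case by fastforce
next
  case (con c ts ss)
  then show ?case by (auto elim: list.rel_mono_strong)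
qed simp

lemma approx_carrier: "approx S s t \<Longrightarrow> s \<in> CTerm_bot S \<and> t \<in> CTerm_bot S"
  by (induction rule: approx.induct)
    (fastforce simp: CTerm_bot_def Term_bot_def list_all2_conv_all_nth in_set_conv_nth)+

lemma approx_antisym: "approx S s t \<Longrightarrow> approx S t s \<Longrightarrow> s = t"
proof (induction s arbitrary: t)
  case (Con c ss)
  from approx_inv[OF Con.prems(1)] obtain ts
    where t: "t = Con c ts" "list_all2 (approx S) ss ts" by auto
  with approx_inv[OF Con.prems(2)] have "list_all2 (approx S) ts ss" by auto
  with t Con.IH have "ss = ts"
    by (auto simp: list_all2_conv_all_nth intro!: nth_equalityI)
  with t show ?case by simp
qed (use approx_inv in fastforce)+

definition down :: "('c, 'f) signature \<Rightarrow> ('c, 'f, 'v) trm \<Rightarrow> ('c, 'f, 'v) trm set" where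
  "down S t = {s \<in> CTerm_bot S. approx S s t}"

definition is_cone :: "('c, 'f) signature \<Rightarrow> ('c, 'f, 'v) trm set \<Rightarrow> bool" where
  "is_cone S K \<longleftrightarrow> K \<noteq> {} \<and> K \<subseteq> CTerm_bot S \<and> (\<forall>t\<in>K. \<forall>s. approx S s t \<longrightarrow> s \<in> K)"


section \<open>Programs and provability\<close>

text \<open>
  \<open>Rule f ts r C\<close> is the rule \<open>f(ts) \<rightarrow> r \<Leftarrow> C\<close>; a pair \<open>(a, b)\<close> in \<open>C\<close> stands for the joinability
  statement between \<open>a\<close> and \<open>b\<close>.
\<close>

datatype ('c, 'f, 'v) crule =
  Rule (head: 'f) (args: "('c, 'f, 'v) trm list") (rhs: "('c, 'f, 'v) trm")
    (conds: "(('c, 'f, 'v) trm \<times> ('c, 'f, 'v) trm) set")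

text \<open>
  The arguments of a rule contain no \<open>Bot\<close>, so their leaves are exactly the variable occurrences and
  \<open>distinct\<close> expresses that no variable occurs twice.
\<close>

definition wf_rule :: "('c, 'f) signature \<Rightarrow> ('c, 'f, 'v) crule \<Rightarrow> bool" where
  "wf_rule S R \<longleftrightarrow>
    fs_arity S (head R) = Some (length (args R)) \<and>
    set (args R) \<subseteq> CTerm S \<and>
    distinct (concat (map leaves (args R))) \<and>
    rhs R \<in> Term_bot S \<and>
    finite (conds R) \<and> conds R \<subseteq> Term S \<times> Term S"

definition program :: "('c, 'f) signature \<Rightarrow> ('c, 'f, 'v) crule set \<Rightarrow> bool" where
  "program S Rs \<longleftrightarrow> (\<forall>R\<in>Rs. wf_rule S R)"

definition subst_rule :: "('v \<Rightarrow> ('c, 'f, 'v) trm) \<Rightarrow> ('c, 'f, 'v) crule \<Rightarrow> ('c, 'f, 'v) crule" where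
  "subst_rule \<theta> R =
    Rule (head R) (map (subst_trm \<theta>) (args R)) (subst_trm \<theta> (rhs R))
      (map_prod (subst_trm \<theta>) (subst_trm \<theta>) ` conds R)"

definition instances_bot :: "('c, 'f) signature \<Rightarrow> ('c, 'f, 'v) crule set \<Rightarrow> ('c, 'f, 'v) crule set" where
  "instances_bot S Rs = {subst_rule \<theta> R | \<theta> R. \<theta> \<in> CSubst_bot S \<and> R \<in> Rs}"

datatype ('c, 'f, 'v) formula =
    Red "('c, 'f, 'v) trm" "('c, 'f, 'v) trm"
  | Join "('c, 'f, 'v) trm" "('c, 'f, 'v) trm"

inductive provable :: "('c, 'f) signature \<Rightarrow> ('c, 'f, 'v) crule set \<Rightarrow> ('c, 'f, 'v) formula \<Rightarrow> bool"
  for S :: "('c, 'f) signature" and Rs :: "('c, 'f, 'v) crule set" where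
  Bo: "e \<in> Term_bot S \<Longrightarrow> provable S Rs (Red e Bot)"
| RR_var: "provable S Rs (Red (Var x) (Var x))"
| RR_con: "ds_arity S c = Some 0 \<Longrightarrow> provable S Rs (Red (Con c []) (Con c []))"
| DS: "ds_arity S c = Some (length ts) \<Longrightarrow>
    list_all2 (\<lambda>e t. provable S Rs (Red e t)) es ts \<Longrightarrow>
    provable S Rs (Red (Con c es) (Con c ts))"
| OR: "Rule f ts r C \<in> instances_bot S Rs \<Longrightarrow> t \<noteq> Bot \<Longrightarrow>
    list_all2 (\<lambda>e t. provable S Rs (Red e t)) es ts \<Longrightarrow>
    (\<And>a b. (a, b) \<in> C \<Longrightarrow> provable S Rs (Join a b)) \<Longrightarrow>
    provable S Rs (Red r t) \<Longrightarrow>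
    provable S Rs (Red (Fun f es) t)"
| Jo: "t \<in> CTerm S \<Longrightarrow> provable S Rs (Red a t) \<Longrightarrow> provable S Rs (Red b t) \<Longrightarrow>
    provable S Rs (Join a b)"


section \<open>Term algebras\<close>

text \<open>
  Carrier and constructors of a term algebra are fixed, so it is given by the interpretation of
  the function symbols.  Outside of the symbols of the signature and of the tuples of the right
  length over the carrier, the value is fixed to \<open>{}\<close> (never a cone); hence equality of algebras
  is equality of these functions.
\<close>

type_synonym ('c, 'f, 'v) algebra = "'f \<Rightarrow> ('c, 'f, 'v) trm list \<Rightarrow> ('c, 'f, 'v) trm set"

definition in_dom :: "('c, 'f) signature \<Rightarrow> 'f \<Rightarrow> ('c, 'f, 'v) trm list \<Rightarrow> bool" where
  "in_dom S f ts \<longleftrightarrow> (\<exists>n. fs_arity S f = Some n \<and> ts \<in> CTuples S n)"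

definition TAlg :: "('c, 'f) signature \<Rightarrow> ('c, 'f, 'v) algebra set" where
  "TAlg S = {A.
    (\<forall>f ts. in_dom S f ts \<longrightarrow> is_cone S (A f ts)) \<and>
    (\<forall>f ss ts. in_dom S f ss \<and> in_dom S f ts \<and> list_all2 (approx S) ss ts \<longrightarrow> A f ss \<subseteq> A f ts) \<and>
    (\<forall>f ts. \<not> in_dom S f ts \<longrightarrow> A f ts = {})}"

definition alg_le :: "('c, 'f) signature \<Rightarrow> ('c, 'f, 'v) algebra \<Rightarrow> ('c, 'f, 'v) algebra \<Rightarrow> bool" where
  "alg_le S A B \<longleftrightarrow> (\<forall>f ts. in_dom S f ts \<longrightarrow> A f ts \<subseteq> B f ts)"

definition consistent :: "('c, 'f) signature \<Rightarrow> ('c, 'f, 'v) algebra \<Rightarrow> bool" where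
  "consistent S A \<longleftrightarrow>
    (\<forall>f ts \<theta>. in_dom S f ts \<and> \<theta> \<in> CSubst S \<longrightarrow>
      {subst_trm \<theta> u | u. u \<in> A f ts} \<subseteq> A f (map (subst_trm \<theta>) ts))"

definition CTAlg :: "('c, 'f) signature \<Rightarrow> ('c, 'f, 'v) algebra set" where
  "CTAlg S = {A \<in> TAlg S. consistent S A}"

text \<open>\<open>listset [K1, ..., Kn]\<close> is the set of tuples \<open>[u1, ..., un]\<close> with \<open>ui \<in> Ki\<close>.\<close>

fun evaluate :: "('c, 'f) signature \<Rightarrow> ('c, 'f, 'v) algebra \<Rightarrow> ('v \<Rightarrow> ('c, 'f, 'v) trm) \<Rightarrow>
    ('c, 'f, 'v) trm \<Rightarrow> ('c, 'f, 'v) trm set" where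
  "evaluate S A \<eta> (Var x) = down S (\<eta> x)"
| "evaluate S A \<eta> Bot = down S Bot"
| "evaluate S A \<eta> (Con c es) = (\<Union>us\<in>listset (map (evaluate S A \<eta>) es). down S (Con c us))"
| "evaluate S A \<eta> (Fun f es) = (\<Union>us\<in>listset (map (evaluate S A \<eta>) es). A f us)"

definition sat_join :: "('c, 'f) signature \<Rightarrow> ('c, 'f, 'v) algebra \<Rightarrow> ('v \<Rightarrow> ('c, 'f, 'v) trm) \<Rightarrow>
    ('c, 'f, 'v) trm \<Rightarrow> ('c, 'f, 'v) trm \<Rightarrow> bool" where
  "sat_join S A \<eta> a b \<longleftrightarrow> (\<exists>t\<in>CTerm S. t \<in> evaluate S A \<eta> a \<inter> evaluate S A \<eta> b)"

definition sat_conds :: "('c, 'f) signature \<Rightarrow> ('c, 'f, 'v) algebra \<Rightarrow> ('v \<Rightarrow> ('c, 'f, 'v) trm) \<Rightarrow>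
    (('c, 'f, 'v) trm \<times> ('c, 'f, 'v) trm) set \<Rightarrow> bool" where
  "sat_conds S A \<eta> C \<longleftrightarrow> (\<forall>(a, b)\<in>C. sat_join S A \<eta> a b)"

text \<open>The identity valuation is \<open>Var\<close>.\<close>

definition T_op :: "('c, 'f) signature \<Rightarrow> ('c, 'f, 'v) crule set \<Rightarrow>
    ('c, 'f, 'v) algebra \<Rightarrow> ('c, 'f, 'v) algebra" where
  "T_op S Rs A f ts =
    (if in_dom S f ts then
      {t. \<exists>ss r C. Rule f ss r C \<in> instances_bot S Rs \<and> list_all2 (approx S) ss ts \<and>
        sat_conds S A Var C \<and> t \<in> evaluate S A Var r} \<union> {Bot}
    else {})"

definition M_alg :: "('c, 'f) signature \<Rightarrow> ('c, 'f, 'v) crule set \<Rightarrow> ('c, 'f, 'v) algebra" where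
  "M_alg S Rs f ts =
    (if in_dom S f ts then {r \<in> CTerm_bot S. provable S Rs (Red (Fun f ts) r)} else {})"


section \<open>Modules and their operations\<close>

record ('c, 'f, 'v) pmodule =
  par_syms :: "'f set"
  exp_syms :: "'f set"
  rl :: "('c, 'f, 'v) crule set"

definition defined_syms :: "('c, 'f, 'v) crule set \<Rightarrow> 'f set" where
  "defined_syms Rs = head ` Rs"

definition occurring_syms :: "('c, 'f, 'v) crule set \<Rightarrow> 'f set" where
  "occurring_syms Rs =
    (\<Union>R\<in>Rs. {head R} \<union> (\<Union>t\<in>set (args R). funs_of t) \<union> funs_of (rhs R) \<union>
      (\<Union>(a, b)\<in>conds R. funs_of a \<union> funs_of b))"

definition module_of :: "('c, 'f, 'v) crule set \<Rightarrow> ('c, 'f, 'v) pmodule" where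
  "module_of Rs = \<lparr>par_syms = occurring_syms Rs - defined_syms Rs, exp_syms = defined_syms Rs, rl = Rs\<rparr>"

definition is_module :: "('c, 'f) signature \<Rightarrow> ('c, 'f, 'v) pmodule \<Rightarrow> bool" where
  "is_module S P \<longleftrightarrow>
    program S (rl P) \<and> (\<forall>R\<in>rl P. rhs R \<noteq> Bot) \<and>
    exp_syms P = defined_syms (rl P) \<and> par_syms P = occurring_syms (rl P) - defined_syms (rl P)"

definition union_mod :: "('c, 'f, 'v) pmodule \<Rightarrow> ('c, 'f, 'v) pmodule \<Rightarrow> ('c, 'f, 'v) pmodule" where
  "union_mod P Q = module_of (rl P \<union> rl Q)"

definition delete_mod :: "'f set \<Rightarrow> ('c, 'f, 'v) pmodule \<Rightarrow> ('c, 'f, 'v) pmodule" where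
  "delete_mod \<sigma> P = module_of {R \<in> rl P. head R \<notin> \<sigma>}"

text \<open>
  \<open>relabel h i t\<close> replaces the \<open>j\<close>-th leaf of \<open>t\<close> (counted from \<open>0\<close>) by the variable \<open>h (i + j)\<close>.
\<close>

fun relabel :: "(nat \<Rightarrow> 'v) \<Rightarrow> nat \<Rightarrow> ('c, 'f, 'v) trm \<Rightarrow> ('c, 'f, 'v) trm"
  and relabels :: "(nat \<Rightarrow> 'v) \<Rightarrow> nat \<Rightarrow> ('c, 'f, 'v) trm list \<Rightarrow> ('c, 'f, 'v) trm list" where
  "relabel h i (Var x) = Var (h i)"
| "relabel h i Bot = Var (h i)"
| "relabel h i (Con c ts) = Con c (relabels h i ts)"
| "relabel h i (Fun f ts) = Fun f (relabels h i ts)"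
| "relabels h i [] = []"
| "relabels h i (t # ts) = relabel h i t # relabels h (i + length (leaves t)) ts"

text \<open>
  In \<open>crr f ts r\<close>, the leaves of the tuple \<open>ts\<close> are numbered from left to right, and the \<open>i\<close>-th
  leaf is replaced by the fresh variable \<open>g i\<close> if it is \<open>Bot\<close> or a repetition of a variable that
  occurs further left.  The map \<open>g\<close> is an injective enumeration of the variables that occur
  neither in \<open>ts\<close> nor in \<open>r\<close> (the type of variables is countably infinite where this is used).
\<close>

definition crr :: "'f \<Rightarrow> ('c, 'f, 'v) trm list \<Rightarrow> ('c, 'f, 'v) trm \<Rightarrow> ('c, 'f, 'v) crule" where
  "crr f ts r =
    (let L = concat (map leaves ts);
         g = from_nat_into (- ((\<Union>t\<in>set ts. vars_of t) \<union> vars_of r));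
         h = (\<lambda>i. case L ! i of None \<Rightarrow> g i | Some x \<Rightarrow> if Some x \<in> set (take i L) then g i else x)
     in Rule f (relabels h 0 ts) r
       ({(Var x, Var (g i)) | x i. i < length L \<and> L ! i = Some x \<and> Some x \<in> set (take i L)} \<union>
        {(Var x, Var x) | x. x \<in> vars_of r \<or> count_list L (Some x) = 1}))"

definition closure_mod :: "('c, 'f) signature \<Rightarrow> 'f set \<Rightarrow> ('c, 'f, 'v) pmodule \<Rightarrow> ('c, 'f, 'v) pmodule" where
  "closure_mod S \<sigma> P = module_of
    {crr f ts r | f ts r. f \<in> \<sigma> \<and> in_dom S f ts \<and> r \<in> CTerm_bot S \<and> r \<noteq> Bot \<and>
      provable S (rl P) (Red (Fun f ts) r)}"

definition is_renaming :: "('c, 'f) signature \<Rightarrow> ('f \<Rightarrow> 'f) \<Rightarrow> bool" where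
  "is_renaming S \<rho> \<longleftrightarrow> (\<forall>f\<in>FS S. fs_arity S (\<rho> f) = fs_arity S f)"

definition rename_trm :: "('f \<Rightarrow> 'f) \<Rightarrow> ('c, 'f, 'v) trm \<Rightarrow> ('c, 'f, 'v) trm" where
  "rename_trm \<rho> = map_trm id \<rho> id"

definition rename_rule :: "('f \<Rightarrow> 'f) \<Rightarrow> ('c, 'f, 'v) crule \<Rightarrow> ('c, 'f, 'v) crule" where
  "rename_rule \<rho> R =
    Rule (\<rho> (head R)) (map (rename_trm \<rho>) (args R)) (rename_trm \<rho> (rhs R))
      (map_prod (rename_trm \<rho>) (rename_trm \<rho>) ` conds R)"

definition rename_mod :: "('f \<Rightarrow> 'f) \<Rightarrow> ('c, 'f, 'v) pmodule \<Rightarrow> ('c, 'f, 'v) pmodule" where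
  "rename_mod \<rho> P = module_of (rename_rule \<rho> ` rl P)"


section \<open>Contexts and equivalences\<close>

definition Ob :: "('c, 'f) signature \<Rightarrow> ('c, 'f, 'v) pmodule \<Rightarrow> ('c, 'f, 'v) algebra" where
  "Ob S P = M_alg S (rl P)"

datatype ('c, 'f, 'v) mcontext =
    Hole
  | Mod "('c, 'f, 'v) pmodule"
  | CUnion "('c, 'f, 'v) mcontext" "('c, 'f, 'v) mcontext"
  | CClosure "'f set" "('c, 'f, 'v) mcontext"
  | CDelete "'f set" "('c, 'f, 'v) mcontext"
  | CRename "'f \<Rightarrow> 'f" "('c, 'f, 'v) mcontext"

fun wf_context :: "('c, 'f) signature \<Rightarrow> ('c, 'f, 'v) mcontext \<Rightarrow> bool" where
  "wf_context S Hole \<longleftrightarrow> True"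
| "wf_context S (Mod M) \<longleftrightarrow> is_module S M"
| "wf_context S (CUnion C D) \<longleftrightarrow> wf_context S C \<and> wf_context S D"
| "wf_context S (CClosure \<sigma> C) \<longleftrightarrow> \<sigma> \<subseteq> FS S \<and> wf_context S C"
| "wf_context S (CDelete \<sigma> C) \<longleftrightarrow> \<sigma> \<subseteq> FS S \<and> wf_context S C"
| "wf_context S (CRename \<rho> C) \<longleftrightarrow> is_renaming S \<rho> \<and> wf_context S C"

fun plug :: "('c, 'f) signature \<Rightarrow> ('c, 'f, 'v) mcontext \<Rightarrow> ('c, 'f, 'v) pmodule \<Rightarrow> ('c, 'f, 'v) pmodule" where
  "plug S Hole P = P"
| "plug S (Mod M) P = M"
| "plug S (CUnion C D) P = union_mod (plug S C P) (plug S D P)"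
| "plug S (CClosure \<sigma> C) P = closure_mod S \<sigma> (plug S C P)"
| "plug S (CDelete \<sigma> C) P = delete_mod \<sigma> (plug S C P)"
| "plug S (CRename \<rho> C) P = rename_mod \<rho> (plug S C P)"

definition CM_equiv :: "('c, 'f) signature \<Rightarrow> ('c, 'f, 'v) pmodule \<Rightarrow> ('c, 'f, 'v) pmodule \<Rightarrow> bool" where
  "CM_equiv S P Q \<longleftrightarrow>
    (\<forall>A\<in>CTAlg S. alg_le S (T_op S (rl P) A) A \<longleftrightarrow> alg_le S (T_op S (rl Q) A) A)"

definition D_equiv :: "('c, 'f) signature \<Rightarrow> ('c, 'f, 'v) pmodule \<Rightarrow> ('c, 'f, 'v) pmodule \<Rightarrow> bool" where
  "D_equiv S P Q \<longleftrightarrow> (\<forall>\<sigma>\<subseteq>FS S. CM_equiv S (delete_mod \<sigma> P) (delete_mod \<sigma> Q))"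

end

theory Submission
  imports Defs
begin

text \<open>
  The context that separates two modules is \<open>(\<X> \<setminus> \<sigma>) \<union> G\<close>, where \<open>G\<close> is a module whose rules are
  the graph of a consistent term algebra \<open>A\<close>: one rule for each \<open>r\<close> in \<open>A f ts\<close>. Consistency makes
  \<open>A\<close> a pre-fixpoint for \<open>G\<close>, and \<open>G\<close> alone already proves all of \<open>A\<close>. Since the provable
  statements form the least pre-fixpoint, \<open>A\<close> is a pre-fixpoint for \<open>P \<setminus> \<sigma>\<close> iff
  \<open>(P \<setminus> \<sigma>) \<union> G\<close> denotes exactly \<open>A\<close>, and the latter is observable.
\<close>

section \<open>Partial terms and evaluation\<close>

lemma CTerm_bot_simps [simp]:
  "Var x \<in> CTerm_bot S" "Bot \<in> CTerm_bot S" "Fun f ts \<notin> CTerm_bot S"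
  "Con c ts \<in> CTerm_bot S \<longleftrightarrow> ds_arity S c = Some (length ts) \<and> set ts \<subseteq> CTerm_bot S"
  by (auto simp: CTerm_bot_def Term_bot_def)

lemma CTerm_simps [simp]:
  "Var x \<in> CTerm S" "Bot \<notin> CTerm S" "Fun f ts \<notin> CTerm S"
  "Con c ts \<in> CTerm S \<longleftrightarrow> ds_arity S c = Some (length ts) \<and> set ts \<subseteq> CTerm S"
  by (auto simp: CTerm_def)

lemma Term_bot_simps [simp]:
  "Var x \<in> Term_bot S" "Bot \<in> Term_bot S"
  "Con c ts \<in> Term_bot S \<longleftrightarrow> ds_arity S c = Some (length ts) \<and> set ts \<subseteq> Term_bot S"
  "Fun f ts \<in> Term_bot S \<longleftrightarrow> fs_arity S f = Some (length ts) \<and> set ts \<subseteq> Term_bot S"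
  by (auto simp: Term_bot_def)

lemma CTerm_subset: "CTerm S \<subseteq> CTerm_bot S"
  by (auto simp: CTerm_def)

lemma CTerm_bot_subset: "CTerm_bot S \<subseteq> Term_bot S"
  by (auto simp: CTerm_bot_def)

lemma subst_Term_bot:
  "\<theta> \<in> CSubst_bot S \<Longrightarrow> t \<in> Term_bot S \<Longrightarrow> subst_trm \<theta> t \<in> Term_bot S"
  by (induction t) (use CTerm_bot_subset in \<open>force simp: CSubst_bot_def\<close>)+

lemma subst_CTerm_bot:
  "\<theta> \<in> CSubst_bot S \<Longrightarrow> t \<in> CTerm_bot S \<Longrightarrow> subst_trm \<theta> t \<in> CTerm_bot S"
  by (induction t) (auto simp: CSubst_bot_def)

lemma subst_trm_cong:
  "(\<And>x. x \<in> vars_of t \<Longrightarrow> \<theta> x = \<theta>' x) \<Longrightarrow> subst_trm \<theta> t = subst_trm \<theta>' t"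
  by (induction t) auto

lemma subst_trm_Var: "subst_trm Var t = t"
  by (induction t) (auto intro: map_idI)

text \<open>A total term has no \<open>Bot\<close> that could be refined, so it is maximal. This is
  what turns a satisfied join condition on partial terms into an equality.\<close>

lemma approx_CTerm_eq: "t \<in> CTerm S \<Longrightarrow> approx S t u \<Longrightarrow> t = u"
proof (induction t arbitrary: u)
  case (Con c ts)
  from approx_inv[OF Con.prems(2)] obtain us
    where "u = Con c us" "list_all2 (approx S) ts us" by auto
  with Con show ?case
    by (auto simp: list_all2_conv_all_nth intro!: nth_equalityI) (metis nth_mem subsetD)
qed (use approx_inv in fastforce)+

lemma in_down: "s \<in> down S t \<longleftrightarrow> approx S s t"
  using approx_carrier by (auto simp: down_def)

lemma in_listset: "us \<in> listset As \<longleftrightarrow> list_all2 (\<in>) us As"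
  by (induction As arbitrary: us) (auto simp: set_Cons_def list_all2_Cons2)

lemma in_listset_map: "us \<in> listset (map F es) \<longleftrightarrow> list_all2 (\<lambda>u e. u \<in> F e) us es"
  by (simp add: in_listset list.rel_map)

lemma in_evaluate_Con:
  "t \<in> evaluate S A \<eta> (Con c es) \<longleftrightarrow>
    (\<exists>us. list_all2 (\<lambda>u e. u \<in> evaluate S A \<eta> e) us es \<and> approx S t (Con c us))"
  by (simp add: in_listset_map in_down Bex_def)

lemma in_evaluate_Fun:
  "t \<in> evaluate S A \<eta> (Fun f es) \<longleftrightarrow>
    (\<exists>us. list_all2 (\<lambda>u e. u \<in> evaluate S A \<eta> e) us es \<and> t \<in> A f us)"
  by (simp add: in_listset_map Bex_def)

lemmas in_evaluate = in_evaluate_Con in_evaluate_Fun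

text \<open>Without function symbols, evaluation merely approximates the arguments, whatever
  \<open>A\<close> is; monotonicity of the constructors makes these approximations of the whole
  term.\<close>

lemma evaluate_CTerm_bot:
  "t \<in> CTerm_bot S \<Longrightarrow> evaluate S A Var t = down S t"
proof (induction t)
  case (Con c ts)
  have eq: "list_all2 (\<lambda>u e. u \<in> evaluate S A Var e) us ts \<longleftrightarrow> list_all2 (approx S) us ts" for us
    using Con by (auto simp: list_all2_conv_all_nth in_down subset_iff)
  have "list_all2 (approx S) ts ts"
    using Con.prems by (auto intro!: list.rel_refl_strong approx.refl)
  moreover have "approx S t (Con c ts)"
    if "list_all2 (approx S) us ts" "approx S t (Con c us)" for t us
    using that Con.prems by (auto intro: approx.trans approx.con)
  ultimately show ?case
    by (auto simp: in_evaluate eq in_down simp del: evaluate.simps)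
qed simp_all

section \<open>Closure properties of term algebras and of evaluation\<close>

lemma TAlg_cone: "A \<in> TAlg S \<Longrightarrow> in_dom S f ts \<Longrightarrow> is_cone S (A f ts)"
  by (simp add: TAlg_def)

lemma TAlg_mono:
  "A \<in> TAlg S \<Longrightarrow> in_dom S f ss \<Longrightarrow> in_dom S f ts \<Longrightarrow> list_all2 (approx S) ss ts \<Longrightarrow>
    A f ss \<subseteq> A f ts"
  by (simp add: TAlg_def)

lemma TAlg_in_dom: "A \<in> TAlg S \<Longrightarrow> t \<in> A f ts \<Longrightarrow> in_dom S f ts"
  unfolding TAlg_def by blast

lemma TAlg_closed:
  assumes "A \<in> TAlg S" "t \<in> A f ts"
  shows "t \<in> CTerm_bot S" and "approx S s t \<Longrightarrow> s \<in> A f ts"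
  using TAlg_cone[OF assms(1) TAlg_in_dom[OF assms]] assms(2) unfolding is_cone_def by blast+

lemma TAlg_Bot: "A \<in> TAlg S \<Longrightarrow> in_dom S f ts \<Longrightarrow> Bot \<in> A f ts"
  using TAlg_cone[of A S f ts] unfolding is_cone_def by (blast intro: approx.bot)

lemma evaluate_closed:
  assumes "A \<in> TAlg S"
  shows "t \<in> evaluate S A \<eta> e \<Longrightarrow> approx S s t \<Longrightarrow> s \<in> evaluate S A \<eta> e"
  using TAlg_closed[OF assms]
  by (cases e) (auto simp: in_evaluate in_down simp del: evaluate.simps(3,4) intro: approx.trans)

lemma evaluate_subset:
  assumes "A \<in> TAlg S"
  shows "evaluate S A \<eta> e \<subseteq> CTerm_bot S"
  using TAlg_closed(1)[OF assms] by (cases e) (auto simp: down_def)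

lemma Bot_in_evaluate:
  assumes "A \<in> TAlg S" "\<eta> \<in> CSubst_bot S"
  shows "e \<in> Term_bot S \<Longrightarrow> Bot \<in> evaluate S A \<eta> e"
proof (induction e)
  case (Con c es)
  \<comment> \<open>\<open>Bot\<close> is chosen as the value of every argument; it is available by
    induction.\<close>
  then have "list_all2 (\<lambda>u e. u \<in> evaluate S A \<eta> e) (replicate (length es) Bot) es"
    by (simp add: list_all2_conv_all_nth subset_iff)
  moreover have "approx S Bot (Con c (replicate (length es) Bot))"
    using Con.prems by (intro approx.bot) auto
  ultimately show ?case
    unfolding in_evaluate by blast
next
  case (Fun f es)
  then have "list_all2 (\<lambda>u e. u \<in> evaluate S A \<eta> e) (replicate (length es) Bot) es"
    by (simp add: list_all2_conv_all_nth subset_iff)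
  moreover have "in_dom S f (replicate (length es) Bot)"
    using Fun.prems by (auto simp: in_dom_def CTuples_def)
  ultimately show ?case
    unfolding in_evaluate using TAlg_Bot[OF assms(1)] by blast
qed (use assms in \<open>auto simp: in_down CSubst_bot_def intro: approx.bot\<close>)


section \<open>Provability and pre-fixpoints\<close>

text \<open>\<open>Bo\<close> cuts off a subterm, while \<open>DS\<close> and \<open>RR_var\<close>
  copy what remains, so the structure of \<open>s\<close> dictates the derivation.\<close>

lemma provable_approx: "approx S s t \<Longrightarrow> provable S Rs (Red t s)"
proof (induction s arbitrary: t)
  case (Var x)
  then show ?case using approx_inv by (fastforce intro: RR_var)
next
  case Bot
  then have "t \<in> Term_bot S" using approx_carrier CTerm_bot_subset by blast
  then show ?case by (rule Bo)
next
  case (Con c ss)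
  from approx_inv[OF Con.prems] obtain ts
    where t: "t = Con c ts" "list_all2 (approx S) ss ts" by auto
  have "ds_arity S c = Some (length ss)"
    using approx_carrier[OF Con.prems] by simp
  moreover have "list_all2 (\<lambda>e t. provable S Rs (Red e t)) ts ss"
    using t Con.IH by (auto simp: list_all2_conv_all_nth)
  ultimately show ?case
    unfolding t by (rule DS)
next
  case (Fun f ss)
  then show ?case using approx_inv by fastforce
qed

lemma provable_refl: "t \<in> CTerm_bot S \<Longrightarrow> provable S Rs (Red t t)"
  by (rule provable_approx[OF approx.refl])

text \<open>A partial constructor term has no function symbol, so \<open>OR\<close> never applies;
  the other rules only copy symbols or cut to \<open>Bot\<close>.\<close>

lemma provable_CTerm_bot:
  "u \<in> CTerm_bot S \<Longrightarrow> provable S Rs (Red u t) \<Longrightarrow> approx S t u"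
proof (induction u arbitrary: t)
  case (Con c us)
  from Con.prems(2) show ?case
  proof cases
    case Bo
    with Con.prems show ?thesis by (auto intro: approx.bot)
  next
    case RR_con
    with Con.prems show ?thesis by (auto intro: approx.refl)
  next
    case (DS ts)
    have "list_all2 (approx S) ts us"
      unfolding list_all2_conv_all_nth
    proof (intro conjI allI impI)
      show len: "length ts = length us"
        using DS(3) by (simp add: list_all2_conv_all_nth)
      fix i assume "i < length ts"
      with len DS(3) have "us ! i \<in> set us" "provable S Rs (Red (us ! i) (ts ! i))"
        by (simp_all add: list_all2_conv_all_nth)
      with Con show "approx S (ts ! i) (us ! i)" by auto
    qed
    with DS Con.prems show ?thesis by (auto intro: approx.con)
  qed
next
  case (Var x)
  from Var(2) show ?case
    by cases (auto intro: approx.refl approx.bot)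
next
  case Bot
  from Bot(2) show ?case
    by cases (auto intro: approx.refl)
qed auto

text \<open>Instantiation may introduce \<open>Bot\<close>, so patterns and conditions are no longer
  total; partial terms are the right carrier for them.\<close>

lemma instance_wf:
  assumes "program S Rs" "Rule f ts r C \<in> instances_bot S Rs"
  shows "in_dom S f ts" "r \<in> Term_bot S" "C \<subseteq> Term_bot S \<times> Term_bot S"
proof -
  obtain \<theta> R where \<theta>: "\<theta> \<in> CSubst_bot S" and "R \<in> Rs" and eq: "Rule f ts r C = subst_rule \<theta> R"
    using assms(2) by (auto simp: instances_bot_def)
  then have "wf_rule S R"
    using assms(1) by (auto simp: program_def)
  then show "in_dom S f ts" "r \<in> Term_bot S" "C \<subseteq> Term_bot S \<times> Term_bot S"
    using eq subst_CTerm_bot[OF \<theta>, OF subsetD[OF CTerm_subset]] subst_Term_bot[OF \<theta>]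
    by (auto simp: subst_rule_def wf_rule_def in_dom_def CTuples_def Term_def subset_iff)
qed

section \<open>Soundness and completeness of the calculus for term algebras\<close>

fun holds :: "('c, 'f) signature \<Rightarrow> ('c, 'f, 'v) algebra \<Rightarrow> ('c, 'f, 'v) formula \<Rightarrow> bool" where
  "holds S A (Red a b) \<longleftrightarrow> b \<in> evaluate S A Var a"
| "holds S A (Join a b) \<longleftrightarrow> sat_join S A Var a b"

text \<open>Induction on derivations: the pre-fixpoint property absorbs \<open>OR\<close>, and the
  other rules match the definitions of \<open>evaluate\<close> and \<open>sat_join\<close>.\<close>

lemma soundness:
  assumes A: "A \<in> TAlg S" and prog: "program S Rs" and pre: "alg_le S (T_op S Rs A) A"
  shows "provable S Rs \<phi> \<Longrightarrow> holds S A \<phi>"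
proof (induction rule: provable.induct)
  case (Bo e)
  then show ?case using Bot_in_evaluate[OF A, of Var] by (simp add: CSubst_bot_def)
next
  case (DS c ts es)
  have *: "list_all2 (\<lambda>u e. u \<in> evaluate S A Var e) ts es"
    using DS.IH by (auto simp: list_all2_conv_all_nth)
  then have "Con c ts \<in> CTerm_bot S"
    using DS.hyps evaluate_subset[OF A]
    by (auto simp: list_all2_conv_all_nth in_set_conv_nth) blast
  with * show ?case
    by (auto simp del: evaluate.simps CTerm_bot_simps simp: in_evaluate intro!: exI[of _ ts] approx.refl)
next
  case (OR f ts r C t es)
  have *: "list_all2 (\<lambda>u e. u \<in> evaluate S A Var e) ts es"
    using OR.IH by (auto simp: list_all2_conv_all_nth)
  have dom: "in_dom S f ts"
    using instance_wf(1)[OF prog OR.hyps(1)] .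
  \<comment> \<open>The instantiated patterns are themselves values of the arguments, so
    \<open>T_op\<close> is used at \<open>ts\<close>, where this instance matches by
    reflexivity.\<close>
  then have "list_all2 (approx S) ts ts"
    by (auto simp: in_dom_def CTuples_def intro!: list.rel_refl_strong approx.refl)
  moreover have "sat_conds S A Var C"
    using OR.IH by (auto simp: sat_conds_def)
  ultimately have "t \<in> T_op S Rs A f ts"
    using OR.hyps(1) OR.IH(3) dom unfolding T_op_def by auto
  with pre dom have "t \<in> A f ts"
    by (auto simp: alg_le_def)
  with * show ?case
    by (auto simp: in_evaluate simp del: evaluate.simps)
qed (auto simp: in_down sat_join_def intro: approx.refl)

text \<open>Soundness yields a value of \<open>f\<close> at some approximation \<open>us\<close> of
  \<open>ts\<close>; monotonicity of \<open>A\<close> lifts it to \<open>ts\<close>.\<close>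

lemma M_alg_le:
  assumes "A \<in> TAlg S" "program S Rs" "alg_le S (T_op S Rs A) A"
  shows "M_alg S Rs f ts \<subseteq> A f ts"
proof
  fix t assume t: "t \<in> M_alg S Rs f ts"
  then have dom: "in_dom S f ts" and "provable S Rs (Red (Fun f ts) t)"
    by (auto simp: M_alg_def split: if_splits)
  with soundness[OF assms] have "t \<in> evaluate S A Var (Fun f ts)"
    by fastforce
  then obtain us where us: "list_all2 (\<lambda>u e. u \<in> evaluate S A Var e) us ts" "t \<in> A f us"
    by (auto simp: in_evaluate simp del: evaluate.simps)
  with dom have "list_all2 (approx S) us ts"
    using evaluate_CTerm_bot[of _ S A]
    by (auto simp: in_dom_def CTuples_def list_all2_conv_all_nth subset_iff in_down)
  with us TAlg_mono[OF assms(1) TAlg_in_dom[OF assms(1) us(2)] dom] show "t \<in> A f ts" by blast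
qed

text \<open>
  An argument \<open>e\<close> reduces to a value \<open>u\<close> and \<open>u\<close> to an instantiated pattern \<open>t\<close>; a partial
  constructor term only reduces to its approximations, so \<open>e\<close> reduces to \<open>t\<close> as \<open>evaluate\<close> is
  closed downwards.
\<close>

lemma completeness:
  assumes M: "M_alg S Rs \<in> TAlg S"
  shows "e \<in> Term_bot S \<Longrightarrow> t \<in> evaluate S (M_alg S Rs) Var e \<Longrightarrow> provable S Rs (Red e t)"
proof (induction e arbitrary: t)
  case (Con c es)
  then obtain us where us: "list_all2 (\<lambda>u e. u \<in> evaluate S (M_alg S Rs) Var e) us es"
    and t: "approx S t (Con c us)"
    by (auto simp: in_evaluate simp del: evaluate.simps)
  show ?case
  proof (cases "t = Bot")
    case True
    with Con.prems show ?thesis by (auto intro: Bo)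
  next
    case False
    with approx_inv[OF t] obtain ts where ts: "t = Con c ts" "list_all2 (approx S) ts us"
      by auto
    have "list_all2 (\<lambda>e t. provable S Rs (Red e t)) es ts"
      unfolding list_all2_conv_all_nth
    proof (intro conjI allI impI)
      show len: "length es = length ts"
        using us ts by (simp add: list_all2_conv_all_nth)
      fix i assume i: "i < length es"
      have "ts ! i \<in> evaluate S (M_alg S Rs) Var (es ! i)"
        by (rule evaluate_closed[OF M, of "us ! i"])
          (use us ts i len in \<open>simp_all add: list_all2_conv_all_nth\<close>)
      then show "provable S Rs (Red (es ! i) (ts ! i))"
        using Con.IH[of "es ! i"] Con.prems(1) i by (auto simp: subset_iff)
    qed
    moreover have "ds_arity S c = Some (length ts)"
      using approx_carrier[OF t] ts by simp
    ultimately show ?thesis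
      unfolding ts(1) by (rule DS[rotated])
  qed
next
  case (Fun f es)
  then obtain us where us: "list_all2 (\<lambda>u e. u \<in> evaluate S (M_alg S Rs) Var e) us es"
    and t: "t \<in> M_alg S Rs f us"
    by (auto simp: in_evaluate simp del: evaluate.simps)
  have prov: "provable S Rs (Red (Fun f us) t)" and dom: "in_dom S f us"
    using t by (auto simp: M_alg_def split: if_splits)
  show ?case
  proof (cases "t = Bot")
    case True
    with Fun.prems show ?thesis by (auto intro: Bo)
  next
    case False
    from prov show ?thesis
    proof cases
      \<comment> \<open>The premises on \<open>C\<close> and \<open>r\<close> do not mention the
        arguments and are reused; only the reductions of the arguments are derived anew, from
        \<open>es\<close>.\<close>
      case (OR ts r C)
      have "list_all2 (\<lambda>e t. provable S Rs (Red e t)) es ts"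
        unfolding list_all2_conv_all_nth
      proof (intro conjI allI impI)
        show len: "length es = length ts"
          using us OR by (simp add: list_all2_conv_all_nth)
        fix i assume i: "i < length es"
        have "us ! i \<in> CTerm_bot S"
          using dom us i by (auto simp: in_dom_def CTuples_def list_all2_conv_all_nth)
        moreover have "provable S Rs (Red (us ! i) (ts ! i))"
          using OR i len by (auto simp: list_all2_conv_all_nth)
        ultimately have "approx S (ts ! i) (us ! i)"
          by (rule provable_CTerm_bot)
        moreover have "us ! i \<in> evaluate S (M_alg S Rs) Var (es ! i)"
          using us i by (simp add: list_all2_conv_all_nth)
        ultimately have "ts ! i \<in> evaluate S (M_alg S Rs) Var (es ! i)"
          by (rule evaluate_closed[OF M, rotated])
        then show "provable S Rs (Red (es ! i) (ts ! i))"
          using Fun.IH[of "es ! i"] Fun.prems(1) i by (auto simp: subset_iff)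
      qed
      then show ?thesis
        by (rule provable.OR[OF OR(1) False _ OR(4,5)])
    qed (use False in auto)
  qed
qed (auto simp: in_down intro: provable_approx)

text \<open>By completeness, values computed in \<open>M_alg\<close> are provable, so one
  application of \<open>T_op\<close> can be replayed by \<open>OR\<close>. Assumption
  \<open>M\<close> is met at the point of use because \<open>M_alg\<close> equals a given term
  algebra there.\<close>

lemma M_alg_pre_fixpoint:
  assumes M: "M_alg S Rs \<in> TAlg S" and prog: "program S Rs"
  shows "alg_le S (T_op S Rs (M_alg S Rs)) (M_alg S Rs)"
  unfolding alg_le_def
proof (intro allI impI subsetI)
  fix f ts t assume dom: "in_dom S f ts" and t: "t \<in> T_op S Rs (M_alg S Rs) f ts"
  show "t \<in> M_alg S Rs f ts"
  proof (cases "t = Bot")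
    case True
    with TAlg_Bot[OF M dom] show ?thesis by simp
  next
    case False
    with t dom obtain ss r C where R: "Rule f ss r C \<in> instances_bot S Rs"
      and ss: "list_all2 (approx S) ss ts" and C: "sat_conds S (M_alg S Rs) Var C"
      and r: "t \<in> evaluate S (M_alg S Rs) Var r"
      by (auto simp: T_op_def)
    note wf = instance_wf[OF prog R]
    have "list_all2 (\<lambda>e t. provable S Rs (Red e t)) ts ss"
      using ss provable_approx by (fastforce simp: list_all2_conv_all_nth)
    moreover have "provable S Rs (Join a b)" if ab: "(a, b) \<in> C" for a b
    proof -
      obtain t where "t \<in> CTerm S"
          "t \<in> evaluate S (M_alg S Rs) Var a" "t \<in> evaluate S (M_alg S Rs) Var b"
        using ab C by (fastforce simp: sat_conds_def sat_join_def)
      with ab wf(3) show ?thesis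
        by (auto intro!: Jo[of t] completeness[OF M])
    qed
    moreover have "provable S Rs (Red r t)"
      using completeness[OF M wf(2) r] .
    ultimately have "provable S Rs (Red (Fun f ts) t)"
      by (rule OR[OF R False])
    with dom r evaluate_subset[OF M] show ?thesis
      by (auto simp: M_alg_def)
  qed
qed


section \<open>The graph of a consistent algebra as a module\<close>

text \<open>
  A simpler variant of \<open>crr\<close>: all leaves of \<open>ts\<close>, also the first occurrences of variables, become
  fresh variables. The conditions force a satisfying instance to be total on the variables of \<open>ts\<close>
  and \<open>r\<close>.
\<close>

definition graph_rule :: "'f \<Rightarrow> ('c, 'f, 'v) trm list \<Rightarrow> ('c, 'f, 'v) trm \<Rightarrow> ('c, 'f, 'v) crule" where
  "graph_rule f ts r =
    (let L = concat (map leaves ts);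
         g = from_nat_into (- ((\<Union>t\<in>set ts. vars_of t) \<union> vars_of r))
     in Rule f (relabels g 0 ts) r
       ({(Var x, Var (g i)) | x i. i < length L \<and> L ! i = Some x} \<union>
        {(Var x, Var x) | x. x \<in> vars_of r}))"

definition graph_rules ::
    "('c, 'f) signature \<Rightarrow> ('c, 'f, 'v) algebra \<Rightarrow> ('c, 'f, 'v) crule set" where
  "graph_rules S A = {graph_rule f ts r | f ts r. in_dom S f ts \<and> r \<in> A f ts \<and> r \<noteq> Bot}"

section \<open>Fresh variables and relabelled leaves\<close>

lemma finite_vars_of [simp]: "finite (vars_of t)"
  by (induction t) auto

lemma vars_of_leaves: "x \<in> vars_of t \<longleftrightarrow> Some x \<in> set (leaves t)"
  by (induction t) auto

text \<open>A finite \<open>V\<close> leaves an infinite countable complement, which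
  \<open>from_nat_into\<close> enumerates bijectively.\<close>

lemma fresh_from_nat_into:
  fixes V :: "'v :: {countable, infinite} set"
  assumes "finite V"
  shows "inj (from_nat_into (- V))" "from_nat_into (- V) i \<notin> V"
proof -
  have "infinite (- V)"
    using assms by (simp add: infinite_UNIV)
  then show "inj (from_nat_into (- V))" "from_nat_into (- V) i \<notin> V"
    using bij_betw_from_nat_into[of "- V"] from_nat_into[of "- V" i]
    by (auto simp: bij_betw_def)
qed

lemma leaves_relabel:
  fixes t :: "('c, 'f, 'v) trm" and ts :: "('c, 'f, 'v) trm list"
  shows "leaves (relabel h i t) = map (\<lambda>j. Some (h j)) [i..<i + length (leaves t)]"
  "concat (map leaves (relabels h i ts)) =
    map (\<lambda>j. Some (h j)) [i..<i + length (concat (map leaves ts))]"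
proof (induction h i t and h i ts rule: relabel_relabels.induct)
  case (6 h i t ts)
  show ?case
    \<comment> \<open>The numbering of \<open>ts\<close> continues where that of \<open>t\<close>
      ends, so the interval splits there.\<close>
    using upt_add_eq_append[of i "i + length (leaves t)" "length (concat (map leaves ts))"]
    by (simp add: 6 add.assoc)
qed simp_all

lemma length_relabels [simp]: "length (relabels h i ts) = length ts"
  by (induction ts arbitrary: i) auto

lemma relabel_CTerm:
  "t \<in> CTerm_bot S \<Longrightarrow> relabel h i t \<in> CTerm S"
  "set ts \<subseteq> CTerm_bot S \<Longrightarrow> set (relabels h i ts) \<subseteq> CTerm S"
  by (induction h i t and h i ts rule: relabel_relabels.induct) auto

text \<open>Relabelling keeps the shape of a term, so sending each new variable back to the leaf it
  replaced undoes it.\<close>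

lemma subst_relabel:
  "(\<And>j. j < length (leaves t) \<Longrightarrow>
      \<theta> (h (i + j)) = (case leaves t ! j of None \<Rightarrow> Bot | Some x \<Rightarrow> Var x)) \<Longrightarrow>
    subst_trm \<theta> (relabel h i t) = t"
  "(\<And>j. j < length (concat (map leaves ts)) \<Longrightarrow>
      \<theta> (h (i + j)) = (case concat (map leaves ts) ! j of None \<Rightarrow> Bot | Some x \<Rightarrow> Var x)) \<Longrightarrow>
    map (subst_trm \<theta>) (relabels h i ts) = ts"
proof (induction h i t and h i ts rule: relabel_relabels.induct)
  case (6 h i t ts)
  have "subst_trm \<theta> (relabel h i t) = t"
    using 6(3)[of j for j] by (intro 6(1)) (simp add: nth_append)
  moreover have "map (subst_trm \<theta>) (relabels h (i + length (leaves t)) ts) = ts"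
    using 6(3)[of "length (leaves t) + j" for j]
    by (intro 6(2)) (simp add: nth_append add.assoc)
  ultimately show ?case by simp
qed auto

text \<open>Only variable leaves are constrained: a \<open>Bot\<close> leaf stays below whatever
  \<open>\<theta>\<close> puts in its place. Hence an approximation instead of an equality.\<close>

lemma approx_subst_relabel:
  assumes "\<theta> \<in> CSubst_bot S" "\<theta>' \<in> CSubst_bot S"
  shows "t \<in> CTerm_bot S \<Longrightarrow>
    (\<And>j x. j < length (leaves t) \<Longrightarrow> leaves t ! j = Some x \<Longrightarrow> \<theta> (h (i + j)) = \<theta>' x) \<Longrightarrow>
    approx S (subst_trm \<theta>' t) (subst_trm \<theta> (relabel h i t))"
  "set ts \<subseteq> CTerm_bot S \<Longrightarrow>
    (\<And>j x. j < length (concat (map leaves ts)) \<Longrightarrow> concat (map leaves ts) ! j = Some x \<Longrightarrow>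
      \<theta> (h (i + j)) = \<theta>' x) \<Longrightarrow>
    list_all2 (approx S) (map (subst_trm \<theta>') ts) (map (subst_trm \<theta>) (relabels h i ts))"
proof (induction h i t and h i ts rule: relabel_relabels.induct)
  case (6 h i t ts)
  have "approx S (subst_trm \<theta>' t) (subst_trm \<theta> (relabel h i t))"
    using 6(3) 6(4)[of j for j] by (intro 6(1)) (auto simp: nth_append)
  moreover have "list_all2 (approx S) (map (subst_trm \<theta>') ts)
      (map (subst_trm \<theta>) (relabels h (i + length (leaves t)) ts))"
    using 6(3) 6(4)[of "length (leaves t) + j" for j]
    by (intro 6(2)) (auto simp: nth_append add.assoc)
  ultimately show ?case by simp
qed (use assms in \<open>auto simp: CSubst_bot_def intro: approx.refl approx.bot approx.con\<close>)

section \<open>Graph rules: well-formedness, what they prove, and what they preserve\<close>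

lemma wf_graph_rule:
  fixes r :: "('c, 'f, 'v :: {countable, infinite}) trm"
  assumes "in_dom S f ts" "r \<in> CTerm_bot S"
  shows "wf_rule S (graph_rule f ts r)"
proof -
  define V where "V = (\<Union>t\<in>set ts. vars_of t) \<union> vars_of r"
  define g where "g = from_nat_into (- V)"
  define L where "L = concat (map leaves ts)"
  have "inj g"
    unfolding g_def by (rule fresh_from_nat_into) (simp add: V_def)
  \<comment> \<open>Distinct leaf numbers receive distinct variables, which makes the patterns
    linear.\<close>
  then have "distinct (concat (map leaves (relabels g 0 ts)))"
    by (auto simp: leaves_relabel distinct_map inj_on_def)
  \<comment> \<open>A linking condition is determined by the number of its leaf.\<close>
  moreover have "finite {(Var x, Var (g i)) | x i. i < length L \<and> L ! i = Some x}"
    by (rule finite_subset[of _ "(\<lambda>i. (Var (the (L ! i)), Var (g i))) ` {..<length L}"]) force+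
  moreover have "Var x \<in> Term S" for x
    by (simp add: Term_def)
  ultimately show ?thesis
    using assms relabel_CTerm(2)[of ts S g 0] CTerm_bot_subset
    by (auto simp: wf_rule_def graph_rule_def Let_def
        V_def[symmetric] g_def[symmetric] L_def[symmetric]
        in_dom_def CTuples_def)
qed

text \<open>Undoing the relabelling gives an instance of the rule with arguments \<open>ts\<close>,
  right-hand side \<open>r\<close> and trivially joinable conditions.\<close>

lemma graph_rule_proves:
  fixes r :: "('c, 'f, 'v :: {countable, infinite}) trm"
  assumes dom: "in_dom S f ts" and r: "r \<in> CTerm_bot S" "r \<noteq> Bot" and R: "graph_rule f ts r \<in> Rs"
  shows "provable S Rs (Red (Fun f ts) r)"
proof -
  define V where "V = (\<Union>t\<in>set ts. vars_of t) \<union> vars_of r"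
  define g where "g = from_nat_into (- V)"
  define L where "L = concat (map leaves ts)"
  have g: "inj g" "g i \<notin> V" for i
    unfolding g_def by (rule fresh_from_nat_into; simp add: V_def)+
  have L: "x \<in> V" if "L ! i = Some x" "i < length L" for i x
    using that nth_mem[of i L] by (auto simp: V_def L_def vars_of_leaves)
  \<comment> \<open>\<open>\<theta>\<close> fixes the original variables and returns each fresh
    \<open>g i\<close> to the leaf it replaced, \<open>Bot\<close> included. The two cases do not
    clash, as \<open>g\<close> avoids \<open>V\<close>.\<close>
  define \<theta> :: "'v \<Rightarrow> ('c, 'f, 'v) trm" where "\<theta> y =
    (if y \<in> V then Var y
     else case L ! inv g y of None \<Rightarrow> Bot | Some x \<Rightarrow> Var x)" for y
  have \<theta>: "\<theta> \<in> CSubst_bot S"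
    by (auto simp: CSubst_bot_def \<theta>_def split: option.split)
  have \<theta>_V: "\<theta> x = Var x" if "x \<in> V" for x
    using that by (simp add: \<theta>_def)
  have \<theta>_g: "\<theta> (g i) = (case L ! i of None \<Rightarrow> Bot | Some x \<Rightarrow> Var x)" for i
    using g by (simp add: \<theta>_def)
  have ts: "map (subst_trm \<theta>) (relabels g 0 ts) = ts"
    by (rule subst_relabel) (simp add: \<theta>_g L_def)
  have "subst_trm \<theta> r = subst_trm Var r"
    by (rule subst_trm_cong) (simp add: \<theta>_V V_def)
  then have "subst_rule \<theta> (graph_rule f ts r) = Rule f ts r
      (map_prod (subst_trm \<theta>) (subst_trm \<theta>) ` conds (graph_rule f ts r))"
    using ts by (simp add: subst_rule_def graph_rule_def Let_def subst_trm_Var V_def g_def)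
  \<comment> \<open>A condition \<open>(Var x, Var (g i))\<close> stems from a leaf
    \<open>x\<close>, so \<open>\<theta>\<close> sends both sides to \<open>Var x\<close>.\<close>
  moreover have "\<exists>x. p = (Var x, Var x)"
    if "p \<in> map_prod (subst_trm \<theta>) (subst_trm \<theta>) ` conds (graph_rule f ts r)" for p
    using that L \<theta>_V \<theta>_g
    by (auto simp: graph_rule_def Let_def V_def[symmetric] g_def[symmetric] L_def[symmetric])
      (simp add: V_def)
  moreover have "subst_rule \<theta> (graph_rule f ts r) \<in> instances_bot S Rs"
    using \<theta> R by (auto simp: instances_bot_def)
  ultimately obtain C where C: "Rule f ts r C \<in> instances_bot S Rs"
    and refl: "\<And>p. p \<in> C \<Longrightarrow> \<exists>x. p = (Var x, Var x)"
    by auto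
  show ?thesis
  proof (rule OR[OF C r(2) _ _ provable_refl[OF r(1)]])
    show "list_all2 (\<lambda>e t. provable S Rs (Red e t)) ts ts"
      using dom by (auto simp: in_dom_def CTuples_def intro!: list.rel_refl_strong provable_refl)
    show "provable S Rs (Join a b)" if "(a, b) \<in> C" for a b
      using refl[OF that] by (auto intro!: Jo RR_var CTerm_simps)
  qed
qed

text \<open>If the conditions of an instance hold in \<open>A\<close>, its substitution is total on
  the variables of \<open>ts\<close> and \<open>r\<close>. Consistency then puts the instance of
  \<open>r\<close> into \<open>A\<close>, and monotonicity moves it to the actual arguments.\<close>

lemma graph_rules_pre_fixpoint:
  fixes A :: "('c, 'f, 'v :: {countable, infinite}) algebra"
  assumes A: "A \<in> CTAlg S"
  shows "alg_le S (T_op S (graph_rules S A) A) A"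
  unfolding alg_le_def
proof (intro allI impI subsetI)
  fix f us t assume dom: "in_dom S f us" and t: "t \<in> T_op S (graph_rules S A) A f us"
  have TA: "A \<in> TAlg S"
    using A by (simp add: CTAlg_def)
  show "t \<in> A f us"
  proof (cases "t = Bot")
    case True
    with TAlg_Bot[OF TA dom] show ?thesis by simp
  next
    case False
    with t dom obtain ss r' C where "Rule f ss r' C \<in> instances_bot S (graph_rules S A)"
      and ss: "list_all2 (approx S) ss us" and C: "sat_conds S A Var C"
      and t: "t \<in> evaluate S A Var r'"
      by (auto simp: T_op_def)
    then obtain \<theta> f' ts r where \<theta>: "\<theta> \<in> CSubst_bot S" and dom_ts: "in_dom S f' ts"
      and r: "r \<in> A f' ts" and eq: "Rule f ss r' C = subst_rule \<theta> (graph_rule f' ts r)"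
      by (auto simp: instances_bot_def graph_rules_def)
    define V where "V = (\<Union>t\<in>set ts. vars_of t) \<union> vars_of r"
    define g where "g = from_nat_into (- V)"
    define L where "L = concat (map leaves ts)"
    note defs = V_def[symmetric] g_def[symmetric] L_def[symmetric]
    have f': "f' = f" and ss_eq: "ss = map (subst_trm \<theta>) (relabels g 0 ts)"
      and r': "r' = subst_trm \<theta> r"
      and C_eq: "C = (\<lambda>(a, b). (subst_trm \<theta> a, subst_trm \<theta> b)) `
        ({(Var x, Var (g i)) | x i. i < length L \<and> L ! i = Some x} \<union>
          {(Var x, Var x) | x. x \<in> vars_of r})"
      using eq by (simp_all add: subst_rule_def graph_rule_def Let_def defs map_prod_def)
    \<comment> \<open>Both sides are partial constructor terms with a common total approximation,
      and by maximality both are equal to it.\<close>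
    have total: "\<theta> x \<in> CTerm S \<and> \<theta> x = \<theta> y" if xy: "(\<theta> x, \<theta> y) \<in> C" for x y
    proof -
      have "\<theta> x \<in> CTerm_bot S" "\<theta> y \<in> CTerm_bot S"
        using \<theta> by (auto simp: CSubst_bot_def)
      moreover obtain s where s: "s \<in> CTerm S"
          "s \<in> evaluate S A Var (\<theta> x)" "s \<in> evaluate S A Var (\<theta> y)"
        using xy C by (fastforce simp: sat_conds_def sat_join_def)
      ultimately have "approx S s (\<theta> x)" "approx S s (\<theta> y)"
        by (simp_all add: evaluate_CTerm_bot in_down)
      with approx_CTerm_eq[OF s(1)] s(1) show ?thesis by blast
    qed
    have leaf: "\<theta> x \<in> CTerm S \<and> \<theta> x = \<theta> (g i)" if "i < length L" "L ! i = Some x" for i x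
      by (rule total) (use that in \<open>force simp: C_eq\<close>)
    have rvar: "\<theta> x \<in> CTerm S" if "x \<in> vars_of r" for x
      using total[of x x] that by (force simp: C_eq)
    \<comment> \<open>Consistency concerns total substitutions only. By \<open>leaf\<close> and
      \<open>rvar\<close>, \<open>\<theta>'\<close> agrees with \<open>\<theta>\<close> on the
      variables of \<open>ts\<close> and \<open>r\<close>; where \<open>\<theta>\<close> is partial,
      \<open>Var x\<close> is an arbitrary total default.\<close>
    define \<theta>' where "\<theta>' x = (if \<theta> x \<in> CTerm S then \<theta> x else Var x)" for x
    have \<theta>': "\<theta>' \<in> CSubst S" "\<theta>' \<in> CSubst_bot S"
      using \<theta> by (auto simp: CSubst_def CSubst_bot_def \<theta>'_def)
    have "subst_trm \<theta>' r = r'"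
      unfolding r' by (rule subst_trm_cong) (simp add: \<theta>'_def rvar)
    then have mem: "r' \<in> A f (map (subst_trm \<theta>') ts)"
      using A r dom_ts \<theta>'(1) unfolding f' CTAlg_def consistent_def by blast
    have ts: "set ts \<subseteq> CTerm_bot S"
      using dom_ts by (auto simp: in_dom_def CTuples_def)
    \<comment> \<open>Fresh variables for \<open>Bot\<close> leaves carry no condition and may take
      any value, so \<open>ss\<close> is only known to lie above the instance of
      \<open>ts\<close>.\<close>
    have "list_all2 (approx S) (map (subst_trm \<theta>') ts) ss"
      unfolding ss_eq
    proof (rule approx_subst_relabel(2)[OF \<theta> \<theta>'(2) ts])
      show "\<theta> (g (0 + j)) = \<theta>' x"
        if "j < length (concat (map leaves ts))" "concat (map leaves ts) ! j = Some x" for j x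
        using leaf[of j x] that by (auto simp: L_def \<theta>'_def)
    qed
    with ss have "list_all2 (approx S) (map (subst_trm \<theta>') ts) us"
      using approx.trans list_all2_trans[of "approx S" "approx S" "approx S"] by blast
    then have "r' \<in> A f us"
      using TAlg_mono[OF TA TAlg_in_dom[OF TA mem] dom] mem by blast
    moreover have "approx S t r'"
      using t TAlg_closed(1)[OF TA mem] by (simp add: evaluate_CTerm_bot in_down)
    ultimately show ?thesis
      by (rule TAlg_closed(2)[OF TA])
  qed
qed

lemma is_module_graph_rules:
  fixes A :: "('c, 'f, 'v :: {countable, infinite}) algebra"
  assumes "A \<in> TAlg S"
  shows "is_module S (module_of (graph_rules S A))"
proof -
  have "rhs R \<noteq> Bot \<and> wf_rule S R" if R: "R \<in> graph_rules S A" for R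
  proof -
    obtain f ts r where "R = graph_rule f ts r" "in_dom S f ts" "r \<in> A f ts" "r \<noteq> Bot"
      using R by (auto simp: graph_rules_def)
    moreover have "rhs (graph_rule f ts r) = r"
      by (simp add: graph_rule_def Let_def)
    ultimately show ?thesis
      using wf_graph_rule TAlg_closed(1)[OF assms] by metis
  qed
  then show ?thesis
    by (auto simp: is_module_def module_of_def program_def)
qed

section \<open>Testing for a pre-fixpoint by adding the graph\<close>

lemma T_op_union:
  "alg_le S (T_op S (Rs \<union> Rs') A) A \<longleftrightarrow> alg_le S (T_op S Rs A) A \<and> alg_le S (T_op S Rs' A) A"
proof -
  have "instances_bot S (Rs \<union> Rs') = instances_bot S Rs \<union> instances_bot S Rs'"
    by (auto simp: instances_bot_def)
  then have "T_op S (Rs \<union> Rs') A f ts = T_op S Rs A f ts \<union> T_op S Rs' A f ts" for f ts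
    by (auto simp: T_op_def)
  then show ?thesis
    unfolding alg_le_def by simp blast
qed

text \<open>Left to right, the denotation is a pre-fixpoint for the union, hence for
  \<open>Rs\<close>. Right to left, \<open>A\<close> is a pre-fixpoint for both parts and so bounds
  the denotation from above, while the graph rules prove every element of \<open>A\<close>.\<close>

lemma M_alg_graph_rules_iff:
  fixes A :: "('c, 'f, 'v :: {countable, infinite}) algebra"
  assumes A: "A \<in> CTAlg S" and prog: "program S Rs"
  shows "M_alg S (Rs \<union> graph_rules S A) = A \<longleftrightarrow> alg_le S (T_op S Rs A) A"
proof -
  have TA: "A \<in> TAlg S"
    using A by (simp add: CTAlg_def)
  have prog': "program S (Rs \<union> graph_rules S A)"
    using prog is_module_graph_rules[OF TA]
    by (auto simp: program_def is_module_def module_of_def)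
  show ?thesis
  proof
    assume "M_alg S (Rs \<union> graph_rules S A) = A"
    with M_alg_pre_fixpoint[OF _ prog'] TA show "alg_le S (T_op S Rs A) A"
      by (simp add: T_op_union)
  next
    assume "alg_le S (T_op S Rs A) A"
    then have "alg_le S (T_op S (Rs \<union> graph_rules S A) A) A"
      using graph_rules_pre_fixpoint[OF A] by (simp add: T_op_union)
    then have le: "M_alg S (Rs \<union> graph_rules S A) f ts \<subseteq> A f ts" for f ts
      by (rule M_alg_le[OF TA prog'])
    have "r \<in> M_alg S (Rs \<union> graph_rules S A) f ts" if r: "r \<in> A f ts" for f ts r
    proof -
      note dom = TAlg_in_dom[OF TA r] and r_C = TAlg_closed(1)[OF TA r]
      have "provable S (Rs \<union> graph_rules S A) (Red (Fun f ts) r)"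
      proof (cases "r = Bot")
        \<comment> \<open>No graph rule has right-hand side \<open>Bot\<close>; this value comes
          from \<open>Bo\<close>.\<close>
        case True
        have "Fun f ts \<in> Term_bot S"
          using dom CTerm_bot_subset by (auto simp: in_dom_def CTuples_def)
        with True show ?thesis by (simp add: Bo)
      next
        case False
        with r dom have "graph_rule f ts r \<in> Rs \<union> graph_rules S A"
          by (auto simp: graph_rules_def)
        with graph_rule_proves[OF dom r_C False] show ?thesis .
      qed
      with dom r_C show ?thesis by (simp add: M_alg_def)
    qed
    with le show "M_alg S (Rs \<union> graph_rules S A) = A"
      by (intro ext) blast
  qed
qed

theorem theorem7p3:
  fixes S :: "('c, 'f) signature"
    and P Q :: "('c, 'f, 'v :: {countable, infinite}) pmodule"
  assumes "countable (dom (ds_arity S))" and "countable (dom (fs_arity S))"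
    and "is_module S P" and "is_module S Q"
    and "\<And>C :: ('c, 'f, 'v) mcontext. wf_context S C \<Longrightarrow> Ob S (plug S C P) = Ob S (plug S C Q)"
  shows "D_equiv S P Q"
  unfolding D_equiv_def CM_equiv_def
proof (intro allI impI ballI)
  fix \<sigma> :: "'f set" and A :: "('c, 'f, 'v) algebra"
  assume \<sigma>: "\<sigma> \<subseteq> FS S" and A: "A \<in> CTAlg S"
  let ?C = "CUnion (CDelete \<sigma> Hole) (Mod (module_of (graph_rules S A)))"
  \<comment> \<open>The pre-fixpoint condition is expressed by an observation of the plugged
    context, compared with the fixed \<open>A\<close>. Equal observations for \<open>P\<close> and
    \<open>Q\<close> therefore make their conditions equivalent.\<close>
  have iff: "Ob S (plug S ?C M) = A \<longleftrightarrow> alg_le S (T_op S (rl (delete_mod \<sigma> M)) A) A"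
    if "is_module S M" for M
    using M_alg_graph_rules_iff[OF A, of "rl (delete_mod \<sigma> M)"] that
    by (simp add: Ob_def union_mod_def module_of_def delete_mod_def is_module_def program_def)
  have "wf_context S ?C"
    using \<sigma> A is_module_graph_rules by (auto simp: CTAlg_def)
  with assms(5) have "Ob S (plug S ?C P) = Ob S (plug S ?C Q)" .
  with iff[OF assms(3)] iff[OF assms(4)]
  show "alg_le S (T_op S (rl (delete_mod \<sigma> P)) A) A \<longleftrightarrow>
      alg_le S (T_op S (rl (delete_mod \<sigma> Q)) A) A"
    by simp
qed

end
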